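(* Let $\alpha$ be a partial action of a unital inverse semigroup $G$ on a $C^*$-algebra $\mathcal{A}$, with $\alpha_g:D_{g^*}\to D_g$, and let $(\pi,u,\mathcal{H})$ be a covariant representation of $\alpha$. Let $$S_G=\{(\alpha_{g_1}\cdots\alpha_{g_n},\,u_{g_1}\cdots u_{g_n}) : n\ge 1,\ g_1,\dots,g_n\in G\}.$$ Then $S_G$ is a unital inverse semigroup with coordinatewise multiplication. For $s=(\alpha_{g_1}\cdots\alpha_{g_n},u_{g_1}\cdots u_{g_n})\in S_G$ let $$E_s=D_{g_1}D_{g_1g_2}\cdots D_{g_1\cdots g_n}\quad\text{and}\quad \beta_s=\alpha_{g_1}\cdots\alpha_{g_n}:E_{s^*}\to E_s.$$ Then $\beta$ is an action of $S_G$ on $\mathcal{A}$.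
   Context: $G$ is an inverse semigroup with unit $e$; $s^*$ denotes the inverse of $s$ in an inverse semigroup. A partial action $\alpha$ of $G$ on a $C^*$-algebra $\mathcal{A}$ consists of closed two-sided ideals $D_g$ of $\mathcal{A}$ ($g\in G$), with $D_e=\mathcal{A}$, and $*$-isomorphisms $\alpha_g:D_{g^*}\to D_g$ such that for all $s,t\in G$: (i) $\alpha_s^{-1}=\alpha_{s^*}$; (ii) $\alpha_s(D_{s^*}\cap D_t)=D_s\cap D_{st}$; (iii) $\alpha_s(\alpha_t(x))=\alpha_{st}(x)$ for all $x\in D_{t^*}\cap D_{t^*s^*}$. A product of closed ideals is the closed linear span of products, equivalently their intersection. The product $\alpha_{g_1}\cdots\alpha_{g_n}$ is the composition of partial maps on its largest possible domain. A covariant representation of $\alpha$ (of $(\mathcal{A},G,\alpha)$) is a triple $(\pi,u,\mathcal{H})$ where $\pi:\mathcal{A}\to B(\mathcal{H})$ is a non-degenerate ($*$-)representation on a Hilbert space $\mathcal{H}$ and, for each $g\in G$, $u_g$ is a partial isometry on $\mathcal{H}$ with initial space $\pi(D_{g^*})\mathcal{H}$ and final space $\pi(D_g)\mathcal{H}$, such that (1) $u_g\pi(a)u_{g^*}=\pi(\alpha_g(a))$ for $a\in D_{g^*}$; (2) $u_{st}h=u_su_th$ for all $h\in\pi(D_{t^*}D_{t^*s^*})\mathcal{H}$; (3) $u_{s^*}=u_s^*$. Here $\pi(I)\mathcal{H}=\{\pi(a)h: a\in I,h\in\mathcal{H}\}$, a closed subspace for every closed ideal $I$. An action of a unital inverse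 semigroup $S$ on $\mathcal{A}$ consists of closed two-sided ideals $E_s$ ($s\in S$), with $E_{1}=\mathcal{A}$ for the unit $1$, and $*$-isomorphisms $\beta_s:E_{s^*}\to E_s$ with $\beta_s\beta_t=\beta_{st}$ as partial maps (composition on largest domain). *)

theory Defs
  imports "HOL-Analysis.Analysis" "HOL-Algebra.Group"
begin

class complex_vector = real_vector +
  fixes scaleC :: "complex \<Rightarrow> 'a \<Rightarrow> 'a" (infixr \<open>*\<^sub>C\<close> 75)
  assumes scaleC_add_right: "c *\<^sub>C (x + y) = c *\<^sub>C x + c *\<^sub>C y"
    and scaleC_add_left: "(c + d) *\<^sub>C x = c *\<^sub>C x + d *\<^sub>C x"
    and scaleC_scaleC: "c *\<^sub>C d *\<^sub>C x = (c * d) *\<^sub>C x"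
    and scaleR_scaleC: "r *\<^sub>R x = complex_of_real r *\<^sub>C x"

global_interpretation complex_vector: vector_space "scaleC :: complex \<Rightarrow> 'a \<Rightarrow> 'a::complex_vector"
  defines csubspace = complex_vector.subspace
    and cspan = complex_vector.span
proof
  show "1 *\<^sub>C x = x" for x :: 'a
    using scaleR_scaleC[of 1 x] by simp
qed (simp_all add: scaleC_add_right scaleC_add_left scaleC_scaleC)

class cbanach = complex_vector + banach +
  assumes norm_scaleC: "norm (c *\<^sub>C x) = cmod c * norm x"

text \<open>The inner product is linear in the first argument.\<close>

class complex_hilbert_space = cbanach +
  fixes cinner :: "'a \<Rightarrow> 'a \<Rightarrow> complex"
  assumes cinner_commute: "cinner x y = cnj (cinner y x)"
    and cinner_add_left: "cinner (x + y) z = cinner x z + cinner y z"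
    and cinner_scaleC_left: "cinner (c *\<^sub>C x) y = c * cinner x y"
    and cinner_self: "cinner x x = complex_of_real ((norm x)\<^sup>2)"

text \<open>A $C^*$-algebra need not have a unit.\<close>

class cstar_algebra = cbanach + real_normed_algebra +
  fixes star :: "'a \<Rightarrow> 'a"
  assumes mult_scaleC_left: "(c *\<^sub>C x) * y = c *\<^sub>C (x * y)"
    and mult_scaleC_right: "x * (c *\<^sub>C y) = c *\<^sub>C (x * y)"
    and star_star: "star (star x) = x"
    and star_add: "star (x + y) = star x + star y"
    and star_scaleC: "star (c *\<^sub>C x) = cnj c *\<^sub>C star x"
    and star_mult: "star (x * y) = star y * star x"
    and cstar_identity: "norm (star x * x) = (norm x)\<^sup>2"

definition closed_ideal :: "'a::cstar_algebra set \<Rightarrow> bool" where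
  "closed_ideal I \<longleftrightarrow> closed I \<and> csubspace I \<and> (\<forall>x\<in>I. \<forall>a. a * x \<in> I \<and> x * a \<in> I)"

definition ideal_prod :: "'a::cstar_algebra set \<Rightarrow> 'a set \<Rightarrow> 'a set" where
  "ideal_prod I J = closure (cspan {x * y | x y. x \<in> I \<and> y \<in> J})"

text \<open>The value at the empty list is a convention that plays no role.\<close>

fun ideal_prod_list :: "'a::cstar_algebra set list \<Rightarrow> 'a set" where
  "ideal_prod_list [] = UNIV"
| "ideal_prod_list [I] = I"
| "ideal_prod_list (I # J # Is) = ideal_prod I (ideal_prod_list (J # Is))"

text \<open>Maps between ideals are partial maps of the algebra, so that the library composition
  \<open>\<circ>\<^sub>m\<close> is composition on the largest possible domain.\<close>

definition star_isomorphism :: "'a::cstar_algebra set \<Rightarrow> 'a set \<Rightarrow> ('a \<rightharpoonup> 'a) \<Rightarrow> bool" where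
  "star_isomorphism I J f \<longleftrightarrow>
     dom f = I \<and> bij_betw (\<lambda>x. the (f x)) I J \<and>
     (\<forall>x\<in>I. \<forall>y\<in>I. the (f (x + y)) = the (f x) + the (f y)) \<and>
     (\<forall>x\<in>I. \<forall>c. the (f (c *\<^sub>C x)) = c *\<^sub>C the (f x)) \<and>
     (\<forall>x\<in>I. \<forall>y\<in>I. the (f (x * y)) = the (f x) * the (f y)) \<and>
     (\<forall>x\<in>I. the (f (star x)) = star (the (f x)))"

definition bounded_clinear :: "('h::complex_hilbert_space \<Rightarrow> 'h) \<Rightarrow> bool" where
  "bounded_clinear T \<longleftrightarrow> bounded_linear T \<and> (\<forall>c x. T (c *\<^sub>C x) = c *\<^sub>C T x)"

definition is_adjoint :: "('h::complex_hilbert_space \<Rightarrow> 'h) \<Rightarrow> ('h \<Rightarrow> 'h) \<Rightarrow> bool" where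
  "is_adjoint S T \<longleftrightarrow> (\<forall>x y. cinner (T x) y = cinner x (S y))"

definition orth_complement :: "'h::complex_hilbert_space set \<Rightarrow> 'h set" where
  "orth_complement M = {y. \<forall>x\<in>M. cinner x y = 0}"

definition initial_space :: "('h::complex_hilbert_space \<Rightarrow> 'h) \<Rightarrow> 'h set" where
  "initial_space T = orth_complement {x. T x = 0}"

definition final_space :: "('h::complex_hilbert_space \<Rightarrow> 'h) \<Rightarrow> 'h set" where
  "final_space T = range T"

definition partial_isometry :: "('h::complex_hilbert_space \<Rightarrow> 'h) \<Rightarrow> bool" where
  "partial_isometry T \<longleftrightarrow> bounded_clinear T \<and> (\<forall>x\<in>initial_space T. norm (T x) = norm x)"

definition rep_space :: "('a::cstar_algebra \<Rightarrow> 'h::complex_hilbert_space \<Rightarrow> 'h) \<Rightarrow> 'a set \<Rightarrow> 'h set" where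
  "rep_space \<pi> I = {\<pi> a h | a h. a \<in> I}"

definition star_representation ::
    "('a::cstar_algebra \<Rightarrow> 'h::complex_hilbert_space \<Rightarrow> 'h) \<Rightarrow> bool" where
  "star_representation \<pi> \<longleftrightarrow>
     (\<forall>a. bounded_clinear (\<pi> a)) \<and>
     (\<forall>a b h. \<pi> (a + b) h = \<pi> a h + \<pi> b h) \<and>
     (\<forall>c a h. \<pi> (c *\<^sub>C a) h = c *\<^sub>C \<pi> a h) \<and>
     (\<forall>a b. \<pi> (a * b) = \<pi> a \<circ> \<pi> b) \<and>
     (\<forall>a. is_adjoint (\<pi> (star a)) (\<pi> a))"

definition nondegenerate :: "('a::cstar_algebra \<Rightarrow> 'h::complex_hilbert_space \<Rightarrow> 'h) \<Rightarrow> bool" where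
  "nondegenerate \<pi> \<longleftrightarrow> closure (cspan (rep_space \<pi> UNIV)) = UNIV"

locale unital_inverse_semigroup = monoid G for G (structure) +
  assumes ex1_inverse: "x \<in> carrier G \<Longrightarrow>
    \<exists>!y. y \<in> carrier G \<and> x \<otimes> y \<otimes> x = x \<and> y \<otimes> x \<otimes> y = y"

text \<open>The inverse \<open>s\<^sup>*\<close> in the sense of inverse semigroups; the library's \<open>m_inv\<close> is the
  group-theoretic inverse and does not apply here.\<close>

definition sinv :: "('g, 'm) monoid_scheme \<Rightarrow> 'g \<Rightarrow> 'g" where
  "sinv G x = (THE y. y \<in> carrier G \<and> x \<otimes>\<^bsub>G\<^esub> y \<otimes>\<^bsub>G\<^esub> x = x \<and> y \<otimes>\<^bsub>G\<^esub> x \<otimes>\<^bsub>G\<^esub> y = y)"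

locale inverse_semigroup_action = unital_inverse_semigroup S for S (structure) +
  fixes E :: "'s \<Rightarrow> 'a::cstar_algebra set" and \<beta> :: "'s \<Rightarrow> 'a \<rightharpoonup> 'a"
  assumes E_ideal: "s \<in> carrier S \<Longrightarrow> closed_ideal (E s)"
    and E_one: "E \<one> = UNIV"
    and \<beta>_iso: "s \<in> carrier S \<Longrightarrow> star_isomorphism (E (sinv S s)) (E s) (\<beta> s)"
    and \<beta>_comp: "s \<in> carrier S \<Longrightarrow> t \<in> carrier S \<Longrightarrow> \<beta> s \<circ>\<^sub>m \<beta> t = \<beta> (s \<otimes> t)"

locale partial_action = unital_inverse_semigroup G for G (structure) +
  fixes D :: "'g \<Rightarrow> 'a::cstar_algebra set" and \<alpha> :: "'g \<Rightarrow> 'a \<rightharpoonup> 'a"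
  assumes D_ideal: "g \<in> carrier G \<Longrightarrow> closed_ideal (D g)"
    and D_one: "D \<one> = UNIV"
    and \<alpha>_iso: "g \<in> carrier G \<Longrightarrow> star_isomorphism (D (sinv G g)) (D g) (\<alpha> g)"
    and \<alpha>_inverse: "s \<in> carrier G \<Longrightarrow> \<alpha> s x = Some y \<longleftrightarrow> \<alpha> (sinv G s) y = Some x"
    and \<alpha>_image: "s \<in> carrier G \<Longrightarrow> t \<in> carrier G \<Longrightarrow>
      (\<lambda>x. the (\<alpha> s x)) ` (D (sinv G s) \<inter> D t) = D s \<inter> D (s \<otimes> t)"
    and \<alpha>_comp: "s \<in> carrier G \<Longrightarrow> t \<in> carrier G \<Longrightarrow>
      x \<in> D (sinv G t) \<inter> D (sinv G t \<otimes> sinv G s) \<Longrightarrow> (\<alpha> s \<circ>\<^sub>m \<alpha> t) x = \<alpha> (s \<otimes> t) x"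

locale covariant_representation = partial_action G D \<alpha>
  for G (structure) and D :: "'g \<Rightarrow> 'a::cstar_algebra set" and \<alpha> :: "'g \<Rightarrow> 'a \<rightharpoonup> 'a" +
  fixes \<pi> :: "'a \<Rightarrow> 'h::complex_hilbert_space \<Rightarrow> 'h" and u :: "'g \<Rightarrow> 'h \<Rightarrow> 'h"
  assumes rep: "star_representation \<pi>"
    and nondegenerate: "nondegenerate \<pi>"
    and u_partial_isometry: "g \<in> carrier G \<Longrightarrow> partial_isometry (u g)"
    and u_initial: "g \<in> carrier G \<Longrightarrow> initial_space (u g) = rep_space \<pi> (D (sinv G g))"
    and u_final: "g \<in> carrier G \<Longrightarrow> final_space (u g) = rep_space \<pi> (D g)"
    and u_covariant: "g \<in> carrier G \<Longrightarrow> a \<in> D (sinv G g) \<Longrightarrow>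
      u g \<circ> \<pi> a \<circ> u (sinv G g) = \<pi> (the (\<alpha> g a))"
    and u_mult: "s \<in> carrier G \<Longrightarrow> t \<in> carrier G \<Longrightarrow>
      h \<in> rep_space \<pi> (ideal_prod (D (sinv G t)) (D (sinv G t \<otimes> sinv G s))) \<Longrightarrow>
      u (s \<otimes> t) h = u s (u t h)"
    and u_adjoint: "s \<in> carrier G \<Longrightarrow> is_adjoint (u (sinv G s)) (u s)"

text \<open>A word \<open>[g\<^sub>1, \<dots>, g\<^sub>n]\<close> with \<open>n \<ge> 1\<close> represents
  \<open>(\<alpha> g\<^sub>1 \<cdots> \<alpha> g\<^sub>n, u g\<^sub>1 \<cdots> u g\<^sub>n)\<close>.\<close>

definition words :: "('g, 'm) monoid_scheme \<Rightarrow> 'g list set" where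
  "words G = {gs. gs \<noteq> [] \<and> set gs \<subseteq> carrier G}"

definition map_word :: "('g \<Rightarrow> 'a \<rightharpoonup> 'a) \<Rightarrow> 'g list \<Rightarrow> ('a \<rightharpoonup> 'a)" where
  "map_word \<alpha> gs = foldr (\<lambda>g f. \<alpha> g \<circ>\<^sub>m f) gs Some"

definition op_word :: "('g \<Rightarrow> 'h \<Rightarrow> 'h) \<Rightarrow> 'g list \<Rightarrow> ('h \<Rightarrow> 'h)" where
  "op_word u gs = foldr (\<lambda>g T. u g \<circ> T) gs id"

definition word_pair ::
    "('g \<Rightarrow> 'a \<rightharpoonup> 'a) \<Rightarrow> ('g \<Rightarrow> 'h \<Rightarrow> 'h) \<Rightarrow> 'g list \<Rightarrow> ('a \<rightharpoonup> 'a) \<times> ('h \<Rightarrow> 'h)" where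
  "word_pair \<alpha> u gs = (map_word \<alpha> gs, op_word u gs)"

definition word_semigroup :: "('g, 'm) monoid_scheme \<Rightarrow> ('g \<Rightarrow> 'a \<rightharpoonup> 'a) \<Rightarrow> ('g \<Rightarrow> 'h \<Rightarrow> 'h) \<Rightarrow>
    (('a \<rightharpoonup> 'a) \<times> ('h \<Rightarrow> 'h)) monoid" where
  "word_semigroup G \<alpha> u =
     \<lparr>carrier = word_pair \<alpha> u ` words G,
      mult = (\<lambda>s t. (fst s \<circ>\<^sub>m fst t, snd s \<circ> snd t)),
      one = (Some, id)\<rparr>"

text \<open>\<open>word_ideal G D [g\<^sub>1, \<dots>, g\<^sub>n]\<close> is
  \<open>D g\<^sub>1 \<cdot> D (g\<^sub>1 g\<^sub>2) \<cdot> \<dots> \<cdot> D (g\<^sub>1 \<cdots> g\<^sub>n)\<close>.\<close>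

definition word_ideal ::
    "('g, 'm) monoid_scheme \<Rightarrow> ('g \<Rightarrow> 'a::cstar_algebra set) \<Rightarrow> 'g list \<Rightarrow> 'a set" where
  "word_ideal G D gs =
     ideal_prod_list (map (\<lambda>k. D (foldr (mult G) (take k gs) (one G))) [1..<Suc (length gs)])"

end

theory Submission
  imports Defs
begin

text \<open>
  The range of \<open>\<alpha> g\<^sub>1 \<cdots> \<alpha> g\<^sub>n\<close> is \<open>D g\<^sub>1 \<inter> D (g\<^sub>1 g\<^sub>2) \<inter> \<dots> \<inter> D (g\<^sub>1 \<cdots> g\<^sub>n)\<close>, and
  products of closed ideals are intersections, so \<open>E s\<close> depends only on the first coordinate of
  \<open>s\<close>. The inverse of the word \<open>[g\<^sub>1, \<dots>, g\<^sub>n]\<close> is \<open>[g\<^sub>n\<^sup>*, \<dots>, g\<^sub>1\<^sup>*]\<close>: if \<open>t\<close> is the operator of a word, then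
  \<open>t t\<^sup>*\<close> lies in the commutant of \<open>\<pi>(A)\<close> (by covariance), hence commutes with the projection onto
  each \<open>\<pi>(D g)H\<close>, and inductively \<open>t\<close> is a partial isometry. Inverses are unique because all
  operators involved are contractions, for which an algebraic inverse is the Moore--Penrose inverse.
\<close>

section \<open>Factorization in closed ideals of \<open>C\<^sup>*\<close>-algebras\<close>

lemma norm_star [simp]: "norm (star x) = norm (x::'a::cstar_algebra)"
proof -
  have *: "norm y \<le> norm (star y)" for y :: 'a
  proof (cases "y = 0")
    case False
    have "norm y * norm y \<le> norm (star y) * norm y"
      using norm_mult_ineq[of "star y" y] cstar_identity[of y] by (simp add: power2_eq_square)
    with False show ?thesis by simp
  qed simp
  from *[of x] *[of "star x"] show ?thesis by (simp add: star_star)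
qed

lemma norm_mult_star: "norm (x * star x) = (norm (x::'a::cstar_algebra))\<^sup>2"
  using cstar_identity[of "star x"] by (simp add: star_star)

text \<open>The coefficient is imaginary and \<open>k\<close> is self-adjoint, so the cross terms of
  \<open>?z * star ?z\<close> cancel and no term of first order in \<open>r\<close> survives. This
  keeps about \<open>1 / r^2\<close> powers of \<open>1 + i r k\<close> bounded.\<close>

lemma norm_add_imaginary_mult_le:
  fixes y k :: "'a::cstar_algebra"
  assumes "star k = k" "norm k \<le> 1"
  shows "(norm (y + (\<i> * complex_of_real r) *\<^sub>C (y * k)))\<^sup>2 \<le> (1 + r\<^sup>2) * (norm y)\<^sup>2"
proof -
  let ?c = "\<i> * complex_of_real r"
  let ?z = "y + ?c *\<^sub>C (y * k)"
  have "?z * star ?z = (y + ?c *\<^sub>C (y * k)) * (star y + cnj ?c *\<^sub>C (k * star y))"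
    by (simp only: star_add star_scaleC star_mult assms(1))
  also have "\<dots> = y * star y + (?c *\<^sub>C (y * k * star y) + cnj ?c *\<^sub>C (y * k * star y))
      + (cnj ?c * ?c) *\<^sub>C (y * k * (k * star y))"
    by (simp only: distrib_left distrib_right mult_scaleC_left mult_scaleC_right scaleC_scaleC
        scaleC_add_right
        mult.assoc add.assoc)
  also have "?c *\<^sub>C (y * k * star y) + cnj ?c *\<^sub>C (y * k * star y) = 0"
    by (simp flip: scaleC_add_left)
  also have "y * star y + 0 + (cnj ?c * ?c) *\<^sub>C (y * k * (k * star y))
      = y * star y + complex_of_real (r\<^sup>2) *\<^sub>C (y * k * star (y * k))"
  proof -
    have "cnj ?c * ?c = complex_of_real (r\<^sup>2)" by (simp add: complex_eq_iff power2_eq_square)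
    thus ?thesis by (simp only: star_mult assms(1) add_0_right)
  qed
  finally have "(norm ?z)\<^sup>2 = norm (y * star y + complex_of_real (r\<^sup>2) *\<^sub>C (y * k * star (y * k)))"
    by (simp add: norm_mult_star[symmetric])
  also have "\<dots> \<le> (norm y)\<^sup>2 + r\<^sup>2 * (norm (y * k))\<^sup>2"
    by (rule norm_triangle_le) (simp add: norm_scaleC norm_mult_star del: of_real_power)
  also have "norm (y * k) \<le> norm y"
    using norm_mult_ineq[of y k] assms(2) mult_left_le[of "norm k" "norm y"] by simp
  hence "(norm y)\<^sup>2 + r\<^sup>2 * (norm (y * k))\<^sup>2 \<le> (1 + r\<^sup>2) * (norm y)\<^sup>2"
    by (simp add: distrib_right mult_left_mono power_mono)
  finally show ?thesis .
qed

text \<open>In the unitization, \<open>unit_power_diff c k n\<close> is \<open>(1 + c k)\<^sup>n - 1\<close>.\<close>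

fun unit_power_diff :: "complex \<Rightarrow> 'a::cstar_algebra \<Rightarrow> nat \<Rightarrow> 'a" where
  "unit_power_diff c k 0 = 0"
| "unit_power_diff c k (Suc n) =
    unit_power_diff c k n + c *\<^sub>C (k + unit_power_diff c k n * k)"

lemma unit_power_diff_commute: "unit_power_diff c k n * k = k * unit_power_diff c k n"
  by (induction n)
    (simp, simp only: unit_power_diff.simps distrib_left distrib_right mult_scaleC_left
        mult_scaleC_right mult.assoc)

lemma unit_power_diff_in_ideal:
  assumes "csubspace I" "\<And>x a. x \<in> I \<Longrightarrow> a * x \<in> I" "k \<in> I"
  shows "unit_power_diff c k n \<in> I"
  by (induction n)
    (auto simp: assms complex_vector.subspace_0 intro!: complex_vector.subspace_add
      complex_vector.subspace_scale)

lemma norm_mult_unit_power_le: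
  fixes y k :: "'a::cstar_algebra"
  assumes "star k = k" "norm k \<le> 1"
  shows "(norm (y + y * unit_power_diff (\<i> * complex_of_real r) k n))\<^sup>2
    \<le> (1 + r\<^sup>2) ^ n * (norm y)\<^sup>2"
proof (induction n)
  case (Suc n)
  let ?c = "\<i> * complex_of_real r"
  let ?p = "unit_power_diff ?c k n"
  have "y + y * unit_power_diff ?c k (Suc n) = (y + y * ?p) + ?c *\<^sub>C ((y + y * ?p) * k)"
    by (simp add: distrib_left distrib_right mult_scaleC_right scaleC_add_right mult.assoc add.assoc)
  also have "(norm \<dots>)\<^sup>2 \<le> (1 + r\<^sup>2) * (norm (y + y * ?p))\<^sup>2"
    by (rule norm_add_imaginary_mult_le[OF assms])
  also have "\<dots> \<le> (1 + r\<^sup>2) * ((1 + r\<^sup>2) ^ n * (norm y)\<^sup>2)"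
    by (rule mult_left_mono[OF Suc]) simp
  finally show ?case by (simp add: mult.assoc)
qed simp

text \<open>The geometric sum \<open>c k (1 + T + ... + T^(N-1)) = T^N - 1\<close> for
  \<open>T = 1 + c k\<close>, written without a unit.\<close>

lemma sum_unit_power_diff:
  "c *\<^sub>C (\<Sum>n<N. k + k * unit_power_diff c k n) = unit_power_diff c k N"
  by (induction N) (simp_all add: complex_vector.scale_right_distrib unit_power_diff_commute)

text \<open>
  Cesaro means: with \<open>k = x\<^sup>* x\<close> and \<open>T = 1 + i k / n\<close>, the powers \<open>T\<^sup>j\<close> for \<open>j \<le> N = n\<^sup>2\<close> have norm at most
  \<open>2\<close>, while \<open>(T\<^sup>N - 1) / N\<close> is \<open>i k / n\<close> times the mean \<open>1 + m\<close> of the \<open>T\<^sup>j\<close>. Hence \<open>k (1 + m)\<close> has norm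
  \<open>O(1/n)\<close>, and then \<open>x (1 + m)\<close> is small by the \<open>C\<^sup>*\<close>-identity.
\<close>

lemma approx_right_unit_unit_ball:
  fixes x :: "'a::cstar_algebra"
  assumes I: "csubspace I" "\<And>x a. x \<in> I \<Longrightarrow> a * x \<in> I" "star x * x \<in> I"
    and x: "norm x \<le> 1" and n: "0 < n"
  shows "\<exists>m\<in>I. (norm (x + x * m))\<^sup>2 \<le> 6 / real n"
proof -
  define k where "k = star x * x"
  define r where "r = 1 / real n"
  define p where "p = unit_power_diff (\<i> * complex_of_real r) k"
  define N where "N = n\<^sup>2"
  define m where "m = (1 / real N) *\<^sub>R (\<Sum>j<N. p j)"
  have N: "real N > 0" using n by (simp add: N_def)
  have k: "star k = k" "norm k \<le> 1" "k \<in> I"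
    using x I(3) power_mono[OF x norm_ge_zero, of 2]
    by (simp_all add: k_def star_mult star_star cstar_identity)
  have pI: "p j \<in> I" for j
    unfolding p_def by (rule unit_power_diff_in_ideal[OF I(1,2) k(3)])
  have mI: "m \<in> I"
    unfolding m_def scaleR_scaleC
    by (intro complex_vector.subspace_scale complex_vector.subspace_sum I(1) pI)
  have pb: "norm (y + y * p j) \<le> 2 * norm y" if "j \<le> N" for j y
  proof -
    \<comment> \<open>The choices \<open>r = 1/n\<close> and \<open>N = n^2\<close> give
      \<open>r^2 N = 1\<close>, so the growth is at most \<open>exp 1 \<le> 4\<close>, whose square
      root is the factor 2.\<close>
    have "(1 + r\<^sup>2) ^ j \<le> (1 + r\<^sup>2) ^ N"
      by (rule power_increasing) (use that in auto)
    also have "\<dots> \<le> exp (r\<^sup>2) ^ N"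
      by (rule power_mono) auto
    also have "\<dots> = exp 1"
      using n by (simp add: r_def N_def power_divide flip: exp_of_nat_mult)
    also have "\<dots> \<le> 4" using exp_le by simp
    finally have "(1 + r\<^sup>2) ^ j * (norm y)\<^sup>2 \<le> 4 * (norm y)\<^sup>2"
      by (rule mult_right_mono) simp
    with norm_mult_unit_power_le[OF k(1,2), of y r j]
    have "(norm (y + y * p j))\<^sup>2 \<le> (2 * norm y)\<^sup>2"
      by (simp add: p_def power_mult_distrib)
    thus ?thesis by (rule power2_le_imp_le) simp
  qed
  have mean: "y + y * m = (1 / real N) *\<^sub>R (\<Sum>j<N. y + y * p j)" for y
    using N by (simp add: m_def sum.distrib sum_distrib_left[symmetric] scaleR_right_distrib
        sum_constant_scaleR)
  have mb: "norm (y + y * m) \<le> 2 * norm y" for y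
  proof -
    have "norm (\<Sum>j<N. y + y * p j) \<le> (\<Sum>j<N. 2 * norm y)"
      by (rule sum_norm_le) (use pb in auto)
    thus ?thesis unfolding mean using N by (simp add: field_simps)
  qed
  \<comment> \<open>Without a unit, \<open>y = 1\<close> cannot be put into \<open>pb\<close>.
    Taking \<open>y = star (p N)\<close> instead bounds the square of \<open>norm (p N)\<close> by a
    multiple of itself.\<close>
  have "norm (p N) * norm (p N) \<le> 3 * norm (p N)"
  proof -
    have "norm (p N) * norm (p N) = norm (star (p N) * p N)"
      by (simp add: cstar_identity power2_eq_square)
    also have "\<dots> = norm ((star (p N) + star (p N) * p N) - star (p N))" by simp
    also have "\<dots> \<le> norm (star (p N) + star (p N) * p N) + norm (star (p N))"
      by (rule norm_triangle_ineq4)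
    also have "\<dots> \<le> 3 * norm (p N)" using pb[of N "star (p N)"] by simp
    finally show ?thesis .
  qed
  hence pN: "norm (p N) \<le> 3" by (cases "p N = 0") simp_all
  have w: "norm (k + k * m) \<le> 3 / real n"
  proof -
    have "norm (p N) = r * norm (\<Sum>j<N. k + k * p j)"
      by (simp add: p_def r_def norm_scaleC norm_mult norm_divide
          flip: sum_unit_power_diff[of _ k N])
    hence "norm (\<Sum>j<N. k + k * p j) = real n * norm (p N)"
      using n by (simp add: r_def)
    hence "norm (k + k * m) = norm (p N) / real n"
      unfolding mean using n by (simp add: N_def power2_eq_square)
    thus ?thesis using pN n by (simp add: divide_right_mono)
  qed
  define z where "z = x + x * m"
  \<comment> \<open>With \<open>z = x (1 + m)\<close> one gets
    \<open>star z * z = star (k (1 + m)) (1 + m)\<close>, so \<open>mb\<close> and \<open>w\<close>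
    combine to the constant \<open>2 * 3 = 6\<close>.\<close>
  have "star z * x = star (k + k * m)"
    by (simp add: z_def k_def star_add star_mult star_star distrib_right mult.assoc)
  hence "star z * z = star (k + k * m) + star (k + k * m) * m"
    by (metis z_def distrib_left mult.assoc)
  hence "(norm z)\<^sup>2 \<le> 2 * norm (k + k * m)"
    using mb[of "star (k + k * m)"] by (simp flip: cstar_identity)
  also have "\<dots> \<le> 6 / real n" using w by simp
  finally show ?thesis using mI z_def by blast
qed

text \<open>Scaling reduces this to the unit ball. Membership is asked of \<open>star x * x\<close>
  rather than of \<open>x\<close> so that the lemma can serve to prove that ideals are closed under
  \<open>star\<close>.\<close>

lemma approx_right_unit:
  fixes x :: "'a::cstar_algebra"
  assumes I: "csubspace I" "\<And>x a. x \<in> I \<Longrightarrow> a * x \<in> I" "star x * x \<in> I" and e: "0 < e"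
  shows "\<exists>m\<in>I. norm (x - x * m) < e"
proof -
  define r where "r = 1 / (norm x + 1)"
  have r: "0 < r" by (simp add: r_def add_nonneg_pos)
  define y where "y = complex_of_real r *\<^sub>C x"
  have y: "norm y \<le> 1"
    using r by (simp add: y_def norm_scaleC) (simp add: r_def field_simps add_nonneg_pos)
  have yI: "star y * y \<in> I"
    by (simp add: y_def star_scaleC mult_scaleC_left mult_scaleC_right scaleC_scaleC
        complex_vector.subspace_scale I(1,3))
  obtain n where n: "6 / (r * e)\<^sup>2 < real n" using reals_Archimedean2 by blast
  have re: "0 < r * e" using r e by simp
  have re2: "0 < (r * e)\<^sup>2" using re by (rule zero_less_power)
  have "0 \<le> 6 / (r * e)\<^sup>2" using re2 by (intro divide_nonneg_pos) auto
  hence "0 < real n" using n by (rule le_less_trans)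
  hence n0: "0 < n" by (rule of_nat_0_less_iff[THEN iffD1])
  obtain m where m: "m \<in> I" "(norm (y + y * m))\<^sup>2 \<le> 6 / real n"
    using approx_right_unit_unit_ball[OF I(1,2) yI y n0] by blast
  have "6 / real n < (r * e)\<^sup>2"
  proof -
    have "6 < real n * (r * e)\<^sup>2"
      using n by (rule pos_divide_less_eq[OF re2, THEN iffD1])
    hence "6 < (r * e)\<^sup>2 * real n" by (simp only: mult.commute)
    thus ?thesis by (rule pos_divide_less_eq[OF \<open>0 < real n\<close>, THEN iffD2])
  qed
  with m(2) have "(norm (y + y * m))\<^sup>2 < (r * e)\<^sup>2" by (rule le_less_trans)
  hence "norm (y + y * m) < r * e"
    using less_imp_le[OF re] by (rule power2_less_imp_less)
  \<comment> \<open>The unit ball version makes \<open>y + y * m\<close> small, so it is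
    \<open>- m\<close> that acts as approximate right unit.\<close>
  also have "y + y * m = complex_of_real r *\<^sub>C (x - x * (- m))"
    by (simp add: y_def mult_scaleC_left complex_vector.scale_right_distrib)
  finally have "norm (x - x * (- m)) < e"
    using r by (simp add: norm_scaleC)
  moreover have "- m \<in> I" using m(1) I(1) by (rule complex_vector.subspace_neg[rotated])
  ultimately show ?thesis by blast
qed

section \<open>Closed ideals: closure under the involution, products as intersections\<close>

lemma closed_idealD:
  assumes "closed_ideal I"
  shows "closed I" "csubspace I" "\<And>x a. x \<in> I \<Longrightarrow> a * x \<in> I" "\<And>x a. x \<in> I \<Longrightarrow> x * a \<in> I"
  using assms by (auto simp: closed_ideal_def)

text \<open>\<open>star x\<close> is a limit of elements \<open>star x * m\<close> with
  \<open>m\<close> in \<open>I\<close>; the approximation applies because \<open>x * star x\<close>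
  lies in \<open>I\<close>.\<close>

lemma closed_ideal_star:
  assumes I: "closed_ideal I" and x: "x \<in> I"
  shows "star x \<in> I"
proof -
  note I' = closed_idealD[OF I]
  have "star x \<in> closure I"
    unfolding closure_approachable
  proof (intro allI impI)
    fix e :: real assume "0 < e"
    then obtain m where "m \<in> I" "norm (star x - star x * m) < e"
      using approx_right_unit[OF I'(2,3), of "star x"] I'(4)[OF x] by (auto simp: star_star)
    hence "star x * m \<in> I" "dist (star x * m) (star x) < e"
      using I'(3) by (auto simp: dist_norm norm_minus_commute)
    thus "\<exists>y\<in>I. dist y (star x) < e" by blast
  qed
  thus ?thesis using I'(1) by simp
qed

text \<open>An \<open>x\<close> in both ideals is a limit of products \<open>x * m\<close> with
  \<open>m\<close> in \<open>J\<close>; the other inclusion is immediate from the ideal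
  properties.\<close>

lemma ideal_prod_eq_Int:
  assumes I: "closed_ideal I" and J: "closed_ideal J"
  shows "ideal_prod I J = I \<inter> J"
proof
  note I' = closed_idealD[OF I] and J' = closed_idealD[OF J]
  have "cspan {x * y |x y. x \<in> I \<and> y \<in> J} \<subseteq> I \<inter> J"
    using I' J' by (intro complex_vector.span_minimal complex_vector.subspace_inter) auto
  thus "ideal_prod I J \<subseteq> I \<inter> J"
    unfolding ideal_prod_def using I'(1) J'(1) by (intro closure_minimal closed_Int)
  show "I \<inter> J \<subseteq> ideal_prod I J"
  proof
    fix x assume x: "x \<in> I \<inter> J"
    show "x \<in> ideal_prod I J"
      unfolding ideal_prod_def closure_approachable
    proof (intro allI impI)
      fix e :: real assume "0 < e"
      have "\<exists>m\<in>J. norm (x - x * m) < e"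
        by (rule approx_right_unit) (use J' x \<open>0 < e\<close> in auto)
      then obtain m where "m \<in> J" "norm (x - x * m) < e" by blast
      moreover have "x * m \<in> cspan {x * y |x y. x \<in> I \<and> y \<in> J}"
        using x \<open>m \<in> J\<close> by (intro complex_vector.span_base) auto
      ultimately show "\<exists>y\<in>cspan {x * y |x y. x \<in> I \<and> y \<in> J}. dist y x < e"
        by (intro bexI[of _ "x * m"]) (simp_all add: dist_norm norm_minus_commute)
    qed
  qed
qed

lemma closed_ideal_Int: "closed_ideal I \<Longrightarrow> closed_ideal J \<Longrightarrow> closed_ideal (I \<inter> J)"
  by (auto simp: closed_ideal_def complex_vector.subspace_inter)

lemma ideal_prod_list_eq_Inter:
  assumes "Is \<noteq> []" "\<And>I. I \<in> set Is \<Longrightarrow> closed_ideal I"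
  shows "ideal_prod_list Is = \<Inter>(set Is) \<and> closed_ideal (\<Inter>(set Is))"
  using assms
  by (induction Is rule: ideal_prod_list.induct)
    (simp_all add: ideal_prod_eq_Int closed_ideal_Int)

section \<open>Operators on Hilbert space\<close>

lemma cinner_diff_left: "cinner (x - y) (z::'h::complex_hilbert_space) = cinner x z - cinner y z"
  using cinner_add_left[of "x - y" y z] by simp

lemma cinner_add_right: "cinner x (y + z::'h::complex_hilbert_space) = cinner x y + cinner x z"
  by (metis cinner_add_left cinner_commute complex_cnj_add)

lemma cinner_diff_right: "cinner x (y - z::'h::complex_hilbert_space) = cinner x y - cinner x z"
  using cinner_add_right[of x "y - z" z] by simp

lemma cinner_scaleC_right: "cinner x (c *\<^sub>C (y::'h::complex_hilbert_space)) = cnj c * cinner x y"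
  by (metis cinner_scaleC_left cinner_commute complex_cnj_mult)

lemma cinner_self_eq_0_iff: "cinner x x = 0 \<longleftrightarrow> x = (0::'h::complex_hilbert_space)"
  by (simp add: cinner_self)

lemma cinner_left_eqI:
  assumes "\<And>y. cinner x y = cinner z (y::'h::complex_hilbert_space)"
  shows "x = z"
  using assms[of "x - z"] cinner_self_eq_0_iff[of "x - z"] by (simp add: cinner_diff_left)

lemma norm_add_squared:
  "(norm (x + y::'h::complex_hilbert_space))\<^sup>2 = (norm x)\<^sup>2 + (norm y)\<^sup>2 + 2 * Re (cinner x y)"
proof -
  have "complex_of_real ((norm (x + y))\<^sup>2) =
      complex_of_real ((norm x)\<^sup>2) + complex_of_real ((norm y)\<^sup>2) + (cinner x y + cnj (cinner x y))"
    by (simp only: cinner_self[symmetric] cinner_add_left cinner_add_right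
        cinner_commute[of y x] ac_simps)
  hence "Re (complex_of_real ((norm (x + y))\<^sup>2)) = Re (complex_of_real ((norm x)\<^sup>2)
      + complex_of_real ((norm y)\<^sup>2) + (cinner x y + cnj (cinner x y)))" by (rule arg_cong)
  thus ?thesis by (simp del: of_real_power)
qed

lemma norm_diff_squared:
  "(norm (x - y::'h::complex_hilbert_space))\<^sup>2 = (norm x)\<^sup>2 + (norm y)\<^sup>2 - 2 * Re (cinner x y)"
  using norm_add_squared[of "x - y" y]
  by (simp add: cinner_diff_left cinner_self[of y] del: of_real_power)

lemma orth_complement_subspace: "csubspace (orth_complement M)"
  by (rule complex_vector.subspaceI)
    (auto simp: orth_complement_def cinner_add_right cinner_scaleC_right
      intro: cinner_diff_right[of _ 0 0, simplified])

lemma bounded_clinearD: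
  assumes "bounded_clinear T"
  shows "bounded_linear T" "T (x + y) = T x + T y" "T (x - y) = T x - T y" "T (c *\<^sub>C x) = c *\<^sub>C T x"
  using assms by (auto simp: bounded_clinear_def linear_simps)

text \<open>Polarization: real parts come from the norm of a sum, imaginary parts from replacing
  \<open>a\<close> by \<open>\<i> *\<^sub>C a\<close>.\<close>

lemma isometric_on_subspace_cinner:
  assumes T: "bounded_clinear T" and M: "csubspace M" and iso: "\<And>x. x \<in> M \<Longrightarrow> norm (T x) = norm x"
    and a: "a \<in> M" and b: "b \<in> M"
  shows "cinner (T a) (T b) = cinner a b"
proof -
  have re: "Re (cinner (T a) (T b)) = Re (cinner a b)" if "a \<in> M" for a
    using norm_add_squared[of a b] norm_add_squared[of "T a" "T b"] iso[OF that] iso[OF b]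
      iso[OF complex_vector.subspace_add[OF M that b]]
    by (simp add: bounded_clinearD[OF T])
  have "\<i> *\<^sub>C a \<in> M" using M a by (simp add: complex_vector.subspace_scale)
  from re[OF this] re[OF a] show ?thesis
    by (simp add: bounded_clinearD[OF T] cinner_scaleC_left complex_eq_iff)
qed

section \<open>Adjoints, contractive idempotents and uniqueness of inverses\<close>

lemma is_adjointD: "is_adjoint S T \<Longrightarrow> cinner (T x) y = cinner x (S y)"
  by (simp add: is_adjoint_def)

lemma is_adjoint_sym: "is_adjoint S T \<Longrightarrow> is_adjoint T S"
  unfolding is_adjoint_def by (metis cinner_commute)

lemma is_adjoint_comp: "is_adjoint S T \<Longrightarrow> is_adjoint S' T' \<Longrightarrow> is_adjoint (S' \<circ> S) (T \<circ> T')"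
  by (simp add: is_adjoint_def)

lemma is_adjoint_unique:
  assumes "is_adjoint T S" "is_adjoint T S'"
  shows "S = S'"
  by (rule ext, rule cinner_left_eqI) (simp add: is_adjointD[OF assms(1)] is_adjointD[OF assms(2)])

text \<open>Expanding the square of \<open>norm (e x - e' (e x))\<close> gives the difference of the
  squares of \<open>norm (e' (e x))\<close> and \<open>norm (e x)\<close>, which contractivity makes
  nonpositive. So \<open>e = e' \<circ> e\<close>, and the right side is self-adjoint.\<close>

lemma contractive_idempotent_self_adjoint:
  assumes adj: "is_adjoint e' e" and idem: "\<And>x. e (e x) = e x" and con: "\<And>x. norm (e' x) \<le> norm x"
  shows "e' = e"
proof -
  have *: "e' (e x) = e x" for x
  proof -
    have "cinner (e x) (e' (e x)) = cinner (e x) (e x)"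
      using is_adjointD[OF adj, of "e x" "e x"] idem by simp
    hence "(norm (e x - e' (e x)))\<^sup>2 = (norm (e' (e x)))\<^sup>2 - (norm (e x))\<^sup>2"
      by (simp add: norm_diff_squared cinner_self del: of_real_power)
    also have "\<dots> \<le> 0" using con[of "e x"] by (simp add: power_mono)
    finally show ?thesis by simp
  qed
  have "is_adjoint (e' \<circ> e) (e' \<circ> e)"
    by (rule is_adjoint_comp[OF is_adjoint_sym[OF adj] adj])
  moreover have "e' \<circ> e = e" using * by auto
  ultimately show ?thesis using is_adjoint_unique adj is_adjoint_sym by metis
qed

text \<open>The products \<open>x y\<close>, \<open>x z\<close>, \<open>y x\<close>,
  \<open>z x\<close> are idempotents with contractive adjoints, hence self-adjoint. Since
  \<open>(x y)(x z) = x z\<close> and \<open>(x z)(x y) = x y\<close>, taking adjoints gives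
  \<open>x y = x z\<close>; likewise \<open>y x = z x\<close>. Then
  \<open>y = y x y = z x z = z\<close>.\<close>

lemma contractive_inverse_unique:
  assumes adj: "is_adjoint x' x" "is_adjoint y' y" "is_adjoint z' z"
    and con: "\<And>v. norm (x' v) \<le> norm v" "\<And>v. norm (y' v) \<le> norm v" "\<And>v. norm (z' v) \<le> norm v"
    and y: "x \<circ> y \<circ> x = x" "y \<circ> x \<circ> y = y" and z: "x \<circ> z \<circ> x = x" "z \<circ> x \<circ> z = z"
  shows "y = z"
proof -
  have sa: "is_adjoint (a \<circ> b) (a \<circ> b)"
    if "is_adjoint a' a" "is_adjoint b' b" "\<And>v. norm (a' v) \<le> norm v" "\<And>v. norm (b' v) \<le> norm v"
      "a \<circ> b \<circ> a = a" for a b a' b' :: "'a \<Rightarrow> 'a"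
  proof -
    have "is_adjoint (b' \<circ> a') (a \<circ> b)" by (rule is_adjoint_comp[OF that(1,2)])
    moreover have "norm ((b' \<circ> a') v) \<le> norm v" for v
      using that(3)[of v] that(4)[of "a' v"] by simp
    moreover have "(a \<circ> b) ((a \<circ> b) v) = (a \<circ> b) v" for v
      using fun_cong[OF that(5), of "b v"] by simp
    ultimately show ?thesis using contractive_idempotent_self_adjoint by metis
  qed
  note xy = sa[OF adj(1,2) con(1,2) y(1)] and xz = sa[OF adj(1,3) con(1,3) z(1)]
  note yx = sa[OF adj(2,1) con(2,1) y(2)] and zx = sa[OF adj(3,1) con(3,1) z(2)]
  have "(x \<circ> y) \<circ> (x \<circ> z) = x \<circ> z" "(x \<circ> z) \<circ> (x \<circ> y) = x \<circ> y"
    by (simp_all only: comp_assoc[symmetric] y z)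
  with is_adjoint_comp[OF xy xz] have r: "x \<circ> y = x \<circ> z"
    using is_adjoint_unique[OF is_adjoint_sym[OF xz]] by (metis is_adjoint_sym)
  have "(y \<circ> x) \<circ> (z \<circ> x) = y \<circ> x" "(z \<circ> x) \<circ> (y \<circ> x) = z \<circ> x"
    by (simp_all add: comp_assoc) (simp_all only: comp_assoc[symmetric] y z)
  with is_adjoint_comp[OF yx zx] have l: "y \<circ> x = z \<circ> x"
    using is_adjoint_unique[OF is_adjoint_sym[OF zx]] by (metis is_adjoint_sym)
  show ?thesis by (metis r l y(2) z(2) comp_assoc)
qed

section \<open>Inverses in the semigroup and in words\<close>

context unital_inverse_semigroup
begin

lemma sinv_props:
  assumes "x \<in> carrier G"
  shows "sinv G x \<in> carrier G" "x \<otimes> sinv G x \<otimes> x = x" "sinv G x \<otimes> x \<otimes> sinv G x = sinv G x"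
  using theI'[OF ex1_inverse[OF assms]] unfolding sinv_def by blast+

lemma sinv_eqI:
  assumes "x \<in> carrier G" "y \<in> carrier G" "x \<otimes> y \<otimes> x = x" "y \<otimes> x \<otimes> y = y"
  shows "sinv G x = y"
  unfolding sinv_def by (rule the1_equality[OF ex1_inverse]) (use assms in auto)

lemma sinv_sinv: "x \<in> carrier G \<Longrightarrow> sinv G (sinv G x) = x"
  by (rule sinv_eqI) (simp_all add: sinv_props)

lemma sinv_one: "sinv G \<one> = \<one>"
  by (rule sinv_eqI) simp_all

end

definition inv_word :: "('g, 'm) monoid_scheme \<Rightarrow> 'g list \<Rightarrow> 'g list" where
  "inv_word G gs = rev (map (sinv G) gs)"

lemma inv_word_simps [simp]:
  "inv_word G [] = []" "inv_word G (g # gs) = inv_word G gs @ [sinv G g]"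
  by (simp_all add: inv_word_def)

lemma (in unital_inverse_semigroup) set_inv_word:
  "set gs \<subseteq> carrier G \<Longrightarrow> set (inv_word G gs) \<subseteq> carrier G"
  by (auto simp: inv_word_def sinv_props)

lemma (in unital_inverse_semigroup) inv_word_inv_word:
  "set gs \<subseteq> carrier G \<Longrightarrow> inv_word G (inv_word G gs) = gs"
  by (simp add: inv_word_def rev_map map_idI sinv_sinv subset_iff)

lemma (in unital_inverse_semigroup) inv_word_words: "gs \<in> words G \<Longrightarrow> inv_word G gs \<in> words G"
  using set_inv_word[of gs] by (auto simp: words_def inv_word_def)

section \<open>Partial maps: composition, inverses and star homomorphisms\<close>

lemma map_comp_assoc: "(f \<circ>\<^sub>m g) \<circ>\<^sub>m h = f \<circ>\<^sub>m (g \<circ>\<^sub>m h)"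
  by (rule ext) (simp add: map_comp_def split: option.split)

lemma Some_map_comp [simp]: "Some \<circ>\<^sub>m f = f" "f \<circ>\<^sub>m Some = f"
  by (rule ext, simp add: map_comp_def split: option.split)+

lemma map_word_simps [simp]:
  "map_word \<alpha> [] = Some" "map_word \<alpha> (g # gs) = \<alpha> g \<circ>\<^sub>m map_word \<alpha> gs"
  by (simp_all add: map_word_def)

lemma map_word_append: "map_word \<alpha> (gs @ hs) = map_word \<alpha> gs \<circ>\<^sub>m map_word \<alpha> hs"
  by (induction gs) (simp_all add: map_comp_assoc)

lemma op_word_simps [simp]: "op_word u [] = id" "op_word u (g # gs) = u g \<circ> op_word u gs"
  by (simp_all add: op_word_def)

lemma op_word_append: "op_word u (gs @ hs) = op_word u gs \<circ> op_word u hs"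
  by (induction gs) (simp_all add: comp_assoc)

text \<open>Each regularity identity yields a point \<open>w\<close> with the same image as the
  given one, and injectivity identifies the two. Thus \<open>g\<close> is the converse relation of
  \<open>f\<close>, which determines it.\<close>

lemma partial_injection_inverse_unique:
  assumes inj: "\<And>x x' y. f x = Some y \<Longrightarrow> f x' = Some y \<Longrightarrow> x = x'"
      "\<And>x x' y. g x = Some y \<Longrightarrow> g x' = Some y \<Longrightarrow> x = x'"
    and fgf: "f \<circ>\<^sub>m g \<circ>\<^sub>m f = f" "g \<circ>\<^sub>m f \<circ>\<^sub>m g = g"
  shows "g y = Some x \<longleftrightarrow> f x = Some y"
proof
  assume *: "g y = Some x"
  hence "(g \<circ>\<^sub>m f \<circ>\<^sub>m g) y = Some x" using fgf by simp
  then obtain w where "f x = Some w" "g w = Some x" using * by (auto simp: map_comp_Some_iff)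
  with inj(2)[OF * this(2)] show "f x = Some y" by simp
next
  assume *: "f x = Some y"
  hence "(f \<circ>\<^sub>m g \<circ>\<^sub>m f) x = Some y" using fgf by simp
  then obtain w where "g y = Some w" "f w = Some y" using * by (auto simp: map_comp_Some_iff)
  with inj(1)[OF * this(2)] show "g y = Some x" by simp
qed

text \<open>Closure of the domain under the operations is part of the condition, so that composition
  on the largest domain preserves it without tracking ideals.\<close>

definition star_partial_hom :: "('a::cstar_algebra \<rightharpoonup> 'a) \<Rightarrow> bool" where
  "star_partial_hom f \<longleftrightarrow>
    (\<forall>x y a b. f x = Some a \<longrightarrow> f y = Some b \<longrightarrow> f (x + y) = Some (a + b) \<and> f (x * y) = Some (a * b)) \<and>
    (\<forall>x a c. f x = Some a \<longrightarrow> f (c *\<^sub>C x) = Some (c *\<^sub>C a) \<and> f (star x) = Some (star a))"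

lemma star_partial_hom_comp:
  "star_partial_hom f \<Longrightarrow> star_partial_hom g \<Longrightarrow> star_partial_hom (f \<circ>\<^sub>m g)"
  unfolding star_partial_hom_def map_comp_Some_iff by blast

text \<open>The domain has to be closed under \<open>star\<close>, and this is where
  \<open>closed_ideal_star\<close> enters.\<close>

lemma star_isomorphism_partial_hom:
  assumes f: "star_isomorphism I J f" and I: "closed_ideal I"
  shows "star_partial_hom f"
proof -
  have some: "f x = Some a \<longleftrightarrow> x \<in> I \<and> the (f x) = a" for x a
    using f by (auto simp: star_isomorphism_def)
  have "x + y \<in> I" "x * y \<in> I" "c *\<^sub>C x \<in> I" "star x \<in> I" if "x \<in> I" "y \<in> I" for x y c
    using that closed_idealD[OF I] closed_ideal_star[OF I]
    by (blast intro: complex_vector.subspace_add complex_vector.subspace_scale)+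
  thus ?thesis
    using f unfolding star_partial_hom_def some star_isomorphism_def by blast
qed

lemma image_the_dom: "(\<lambda>x. the (f x)) ` dom f = ran f"
proof
  show "ran f \<subseteq> (\<lambda>x. the (f x)) ` dom f"
  proof
    fix y assume "y \<in> ran f"
    then obtain x where "f x = Some y" by (auto simp: ran_def)
    thus "y \<in> (\<lambda>x. the (f x)) ` dom f" by (intro image_eqI[of _ _ x]) auto
  qed
qed (auto intro: ranI)

lemma star_partial_hom_isomorphism:
  assumes hom: "star_partial_hom f" and inj: "\<And>x x' y. f x = Some y \<Longrightarrow> f x' = Some y \<Longrightarrow> x = x'"
  shows "star_isomorphism (dom f) (ran f) f"
proof -
  have "bij_betw (\<lambda>x. the (f x)) (dom f) (ran f)"
  proof (rule bij_betw_imageI[OF inj_onI image_the_dom])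
    fix x x' assume "x \<in> dom f" "x' \<in> dom f" and eq: "the (f x) = the (f x')"
    then obtain a where a: "f x = Some a" "f x' = Some a" by auto
    show "x = x'" by (rule inj[OF a])
  qed
  moreover have "f x = Some (the (f x))" if "x \<in> dom f" for x
    using that by auto
  note some = this
  have "f (x + y) = Some (the (f x) + the (f y))" "f (x * y) = Some (the (f x) * the (f y))"
    if "x \<in> dom f" "y \<in> dom f" for x y
    using hom some[OF that(1)] some[OF that(2)] unfolding star_partial_hom_def by blast+
  moreover have "f (c *\<^sub>C x) = Some (c *\<^sub>C the (f x))" "f (star x) = Some (star (the (f x)))"
    if "x \<in> dom f" for x c
    using hom some[OF that] unfolding star_partial_hom_def by blast+
  ultimately show ?thesis by (simp add: star_isomorphism_def)
qed

section \<open>Words in a partial action\<close>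

context partial_action
begin

lemma ran_\<alpha>: "g \<in> carrier G \<Longrightarrow> ran (\<alpha> g) = D g"
  using \<alpha>_iso[of g] image_the_dom[of "\<alpha> g"] by (simp add: star_isomorphism_def bij_betw_def)

lemma dom_\<alpha>: "g \<in> carrier G \<Longrightarrow> dom (\<alpha> g) = D (sinv G g)"
  using \<alpha>_iso[of g] by (simp add: star_isomorphism_def)

lemma \<alpha>_inj: "g \<in> carrier G \<Longrightarrow> \<alpha> g x = Some y \<Longrightarrow> \<alpha> g x' = Some y \<Longrightarrow> x = x'"
  using \<alpha>_inverse[of g x y] \<alpha>_inverse[of g x' y] by simp

text \<open>As the unit is its own inverse, \<open>\<alpha> \<one>\<close> is an involution; by the
  composition axiom it is also idempotent.\<close>

lemma \<alpha>_one: "\<alpha> \<one> = Some"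
proof
  fix x
  obtain y where y: "\<alpha> \<one> x = Some y"
    using dom_\<alpha>[of \<one>] by (auto simp: sinv_one D_one dom_def)
  hence "\<alpha> \<one> y = Some x" using \<alpha>_inverse[OF one_closed, of x y] unfolding sinv_one by blast
  moreover have "(\<alpha> \<one> \<circ>\<^sub>m \<alpha> \<one>) x = \<alpha> (\<one> \<otimes> \<one>) x"
    by (rule \<alpha>_comp) (simp_all add: sinv_one D_one)
  ultimately show "\<alpha> \<one> x = Some x" using y by (simp add: map_comp_def)
qed

text \<open>Pointwise form of the image axiom. From right to left the axiom only supplies some
  preimage in \<open>D h\<close>, which injectivity identifies with \<open>z\<close>.\<close>

lemma \<alpha>_mem_iff:
  assumes g: "g \<in> carrier G" and h: "h \<in> carrier G" and z: "\<alpha> g z = Some y"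
  shows "z \<in> D h \<longleftrightarrow> y \<in> D (g \<otimes> h)"
proof -
  have zD: "z \<in> D (sinv G g)" using z dom_\<alpha>[OF g] by auto
  show ?thesis
  proof
    assume "z \<in> D h"
    with zD have "the (\<alpha> g z) \<in> D g \<inter> D (g \<otimes> h)" unfolding \<alpha>_image[OF g h, symmetric] by blast
    thus "y \<in> D (g \<otimes> h)" using z by simp
  next
    assume "y \<in> D (g \<otimes> h)"
    moreover have "y \<in> D g" using z ran_\<alpha>[OF g] by (auto simp: ran_def)
    ultimately have "y \<in> (\<lambda>x. the (\<alpha> g x)) ` (D (sinv G g) \<inter> D h)"
      unfolding \<alpha>_image[OF g h] by blast
    then obtain z' where z': "z' \<in> D h" "z' \<in> D (sinv G g)" "y = the (\<alpha> g z')" by blast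
    then obtain y' where "\<alpha> g z' = Some y'" using dom_\<alpha>[OF g] by blast
    with z'(3) have "\<alpha> g z' = Some y" by simp
    with z have "z = z'" by (rule \<alpha>_inj[OF g])
    with z'(1) show "z \<in> D h" by simp
  qed
qed

lemma map_word_inv:
  "set gs \<subseteq> carrier G \<Longrightarrow> map_word \<alpha> gs x = Some y \<longleftrightarrow> map_word \<alpha> (inv_word G gs) y = Some x"
proof (induction gs arbitrary: x y)
  case (Cons g gs)
  hence "map_word \<alpha> gs x = Some z \<longleftrightarrow> map_word \<alpha> (inv_word G gs) z = Some x"
    "\<alpha> g z = Some y \<longleftrightarrow> \<alpha> (sinv G g) y = Some z" for z
    using \<alpha>_inverse[of g] by simp_all
  thus ?case by (auto simp: map_word_append map_comp_Some_iff)
qed auto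

lemma map_word_inj:
  "set gs \<subseteq> carrier G \<Longrightarrow> map_word \<alpha> gs x = Some y \<Longrightarrow> map_word \<alpha> gs x' = Some y \<Longrightarrow> x = x'"
  using map_word_inv[of gs x y] map_word_inv[of gs x' y] by simp

lemma ran_map_word_inv:
  "set gs \<subseteq> carrier G \<Longrightarrow> ran (map_word \<alpha> (inv_word G gs)) = dom (map_word \<alpha> gs)"
  by (auto simp: ran_def dom_def map_word_inv)

lemma star_partial_hom_map_word: "set gs \<subseteq> carrier G \<Longrightarrow> star_partial_hom (map_word \<alpha> gs)"
proof (induction gs)
  case Nil
  show ?case by (simp add: star_partial_hom_def)
next
  case (Cons g gs)
  thus ?case
    using star_isomorphism_partial_hom[OF \<alpha>_iso D_ideal, of g]
    by (simp add: star_partial_hom_comp sinv_props)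
qed

lemma foldr_mult_closed: "set gs \<subseteq> carrier G \<Longrightarrow> foldr (\<otimes>) gs \<one> \<in> carrier G"
  by (induction gs) auto

text \<open>Induction on the first letter: a preimage \<open>z\<close> of \<open>y\<close> under
  \<open>\<alpha> g\<close> exists iff \<open>y\<close> is in \<open>D g\<close>, and
  \<open>\<alpha>_mem_iff\<close> turns each condition \<open>z \<in> D h\<close> on it into
  \<open>y \<in> D (g \<otimes> h)\<close>.\<close>

lemma mem_ran_map_word:
  "set gs \<subseteq> carrier G \<Longrightarrow>
    y \<in> ran (map_word \<alpha> gs) \<longleftrightarrow> (\<forall>k\<in>{1..length gs}. y \<in> D (foldr (\<otimes>) (take k gs) \<one>))"
proof (induction gs arbitrary: y)
  case Nil
  thus ?case by (simp add: ran_def)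
next
  case (Cons g gs)
  hence g: "g \<in> carrier G" and gs: "set gs \<subseteq> carrier G" by auto
  have closed: "foldr (\<otimes>) (take k gs) \<one> \<in> carrier G" for k
    using foldr_mult_closed[of "take k gs"] gs set_take_subset[of k gs] by blast
  have "y \<in> ran (map_word \<alpha> (g # gs)) \<longleftrightarrow> (\<exists>z. \<alpha> g z = Some y \<and> z \<in> ran (map_word \<alpha> gs))"
    by (auto simp: ran_def map_comp_Some_iff)
  also have "\<dots> \<longleftrightarrow> (\<exists>z. \<alpha> g z = Some y \<and>
      (\<forall>k\<in>{1..length gs}. y \<in> D (g \<otimes> foldr (\<otimes>) (take k gs) \<one>)))"
    using Cons.IH[OF gs] \<alpha>_mem_iff[OF g closed] by auto
  also have "\<dots> \<longleftrightarrow> y \<in> ran (\<alpha> g) \<and>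
      (\<forall>k\<in>{1..length gs}. y \<in> D (g \<otimes> foldr (\<otimes>) (take k gs) \<one>))"
    by (auto simp: ran_def)
  also have "\<dots> \<longleftrightarrow> (\<forall>k\<in>{1..length (g # gs)}. y \<in> D (foldr (\<otimes>) (take k (g # gs)) \<one>))"
  proof -
    \<comment> \<open>Index 1 accounts for \<open>D g\<close>; index \<open>Suc k\<close> accounts
      for the prefix of length \<open>k\<close> of \<open>gs\<close>, multiplied by
      \<open>g\<close>.\<close>
    have *: "{1..length (g # gs)} = insert 1 (Suc ` {1..length gs})"
      by (simp add: image_Suc_atLeastAtMost atLeastAtMost_insertL)
    show ?thesis unfolding * using g by (simp add: ran_\<alpha> del: image_Suc_atLeastAtMost)
  qed
  finally show ?case .
qed

text \<open>This makes the product of ideals well defined on the semigroup: the range depends on the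
  partial map alone, not on the word chosen for it.\<close>

lemma word_ideal_eq:
  assumes "gs \<in> words G"
  shows "word_ideal G D gs = ran (map_word \<alpha> gs)" "closed_ideal (word_ideal G D gs)"
proof -
  have gs: "gs \<noteq> []" "set gs \<subseteq> carrier G" using assms by (auto simp: words_def)
  let ?Is = "map (\<lambda>k. D (foldr (\<otimes>) (take k gs) \<one>)) [1..<Suc (length gs)]"
  have "closed_ideal I" if "I \<in> set ?Is" for I
    using that gs(2) by (auto intro!: D_ideal foldr_mult_closed dest: in_set_takeD)
  hence *: "ideal_prod_list ?Is = \<Inter>(set ?Is) \<and> closed_ideal (\<Inter>(set ?Is))"
    by (intro ideal_prod_list_eq_Inter) (use gs(1) in \<open>simp add: Suc_le_eq\<close>)
  thus "closed_ideal (word_ideal G D gs)" by (simp only: word_ideal_def)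
  have "y \<in> \<Inter>(set ?Is) \<longleftrightarrow> y \<in> ran (map_word \<alpha> gs)" for y
    unfolding mem_ran_map_word[OF gs(2)] set_map set_upt atLeastLessThanSuc_atLeastAtMost by blast
  with * show "word_ideal G D gs = ran (map_word \<alpha> gs)" by (auto simp only: word_ideal_def)
qed

end

section \<open>Words in a covariant representation\<close>

text \<open>Taking adjoints in \<open>Q R' Q = R' Q\<close> gives \<open>Q R Q = Q R\<close>, to be
  compared with \<open>Q R Q = R Q\<close>.\<close>

lemma projection_commute:
  assumes Q: "is_adjoint Q Q" and R: "is_adjoint R' R"
    and inv: "\<And>x. Q (R (Q x)) = R (Q x)" "\<And>x. Q (R' (Q x)) = R' (Q x)"
  shows "Q (R x) = R (Q x)"
proof (rule cinner_left_eqI)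
  fix y
  have "cinner (Q (R x)) y = cinner x (R' (Q y))"
    by (simp add: is_adjointD[OF Q] is_adjointD[OF R])
  also have "\<dots> = cinner (Q (R (Q x))) y"
    by (simp add: is_adjointD[OF Q] is_adjointD[OF R] inv(2))
  finally show "cinner (Q (R x)) y = cinner (R (Q x)) y" by (simp add: inv(1))
qed

context covariant_representation
begin

lemma \<pi>_mult: "\<pi> (a * b) h = \<pi> a (\<pi> b h)"
  using rep by (simp add: star_representation_def)

lemma \<pi>_adjoint: "is_adjoint (\<pi> (star a)) (\<pi> a)"
  using rep by (simp add: star_representation_def)

lemma u_clinear: "g \<in> carrier G \<Longrightarrow> bounded_clinear (u g)"
  using u_partial_isometry by (simp add: partial_isometry_def)

lemma u_in_rep_space: "g \<in> carrier G \<Longrightarrow> u g x \<in> rep_space \<pi> (D g)"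
  using u_final by (auto simp: final_space_def)

text \<open>The difference \<open>?y\<close> lies in the initial space, where \<open>u g\<close>
  preserves inner products. Hence \<open>?y\<close> has the same inner product with \<open>x\<close>
  as with \<open>u (sinv G g) (u g x)\<close>, so it is orthogonal to itself.\<close>

lemma u_sinv_u:
  assumes g: "g \<in> carrier G" and x: "x \<in> rep_space \<pi> (D (sinv G g))"
  shows "u (sinv G g) (u g x) = x"
proof -
  let ?M = "initial_space (u g)" and ?y = "u (sinv G g) (u g x) - x"
  have M: "csubspace ?M" by (simp add: initial_space_def orth_complement_subspace)
  have xM: "x \<in> ?M" using x u_initial[OF g] by simp
  have "u (sinv G g) (u g x) \<in> ?M"
    using u_initial[OF g] u_in_rep_space[OF sinv_props(1)[OF g]] by simp
  hence y: "?y \<in> ?M" by (rule complex_vector.subspace_diff[OF M _ xM])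
  have "cinner (u g ?y) (u g x) = cinner ?y x"
    by (rule isometric_on_subspace_cinner[OF u_clinear[OF g] M _ y xM])
      (use u_partial_isometry[OF g] in \<open>simp add: partial_isometry_def\<close>)
  moreover have "cinner (u g ?y) (u g x) = cinner ?y (u (sinv G g) (u g x))"
    by (rule is_adjointD[OF u_adjoint[OF g]])
  ultimately have "cinner ?y ?y = 0" by (simp add: cinner_diff_right)
  thus ?thesis by (simp add: cinner_self_eq_0_iff)
qed

lemma u_u_sinv:
  "g \<in> carrier G \<Longrightarrow> x \<in> rep_space \<pi> (D g) \<Longrightarrow> u g (u (sinv G g) x) = x"
  using u_sinv_u[of "sinv G g" x] by (simp add: sinv_sinv sinv_props)

lemma u_u_sinv_u: "g \<in> carrier G \<Longrightarrow> u g (u (sinv G g) (u g x)) = u g x"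
  by (simp add: u_u_sinv u_in_rep_space)

text \<open>Pythagoras for \<open>?p\<close>, the projection of \<open>x\<close> onto the initial
  space, which has the same norm as \<open>u g x\<close>.\<close>

lemma u_contraction:
  assumes g: "g \<in> carrier G"
  shows "norm (u g x) \<le> norm x"
proof -
  let ?p = "u (sinv G g) (u g x)"
  have n: "cinner (u g z) (u g z) = cinner z (u (sinv G g) (u g z))" for z
    by (rule is_adjointD[OF u_adjoint[OF g]])
  have p: "cinner ?p ?p = cinner (u g x) (u g x)"
    using is_adjointD[OF u_adjoint[OF sinv_props(1)[OF g]], of "u g x" ?p]
    by (simp add: sinv_sinv g u_u_sinv_u)
  have "Re (cinner x ?p) = (norm (u g x))\<^sup>2" "(norm ?p)\<^sup>2 = (norm (u g x))\<^sup>2"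
    using arg_cong[OF n[of x], of Re] arg_cong[OF p, of Re]
    by (simp_all add: cinner_self del: of_real_power)
  hence "(norm (x - ?p))\<^sup>2 = (norm x)\<^sup>2 - (norm (u g x))\<^sup>2"
    by (simp add: norm_diff_squared)
  hence "(norm (u g x))\<^sup>2 \<le> (norm x)\<^sup>2"
    using zero_le_power2[of "norm (x - ?p)"] by linarith
  thus ?thesis by (rule power2_le_imp_le) simp
qed

text \<open>The square of \<open>u \<one>\<close> fixes \<open>\<pi>(A)H\<close>, hence everything
  by nondegeneracy and continuity. Multiplicativity then gives
  \<open>u \<one> = u \<one> \<circ> u \<one> = id\<close>.\<close>

lemma u_one: "u \<one> = id"
proof -
  define Q where "Q = u \<one> \<circ> u \<one>"
  have Q: "bounded_clinear Q"
    using u_clinear[OF one_closed] bounded_linear_compose[of "u \<one>" "u \<one>"]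
    by (simp add: Q_def bounded_clinear_def comp_def)
  have fixed: "Q x = x" if "x \<in> rep_space \<pi> UNIV" for x
    using u_sinv_u[of \<one> x] that by (simp add: Q_def sinv_one D_one)
  have "csubspace {x. Q x = x}"
    by (rule complex_vector.subspaceI)
      (use bounded_clinearD[OF Q] in \<open>auto simp: linear_simps\<close>)
  hence "cspan (rep_space \<pi> UNIV) \<subseteq> {x. Q x = x}"
    using fixed by (intro complex_vector.span_minimal) auto
  moreover have "closed {x. Q x = x}"
    by (intro closed_Collect_eq continuous_on_id
        linear_continuous_on[OF bounded_clinearD(1)[OF Q]])
  ultimately have "closure (cspan (rep_space \<pi> UNIV)) \<subseteq> {x. Q x = x}"
    by (rule closure_minimal)
  hence uu: "u \<one> (u \<one> x) = x" for x
    using nondegenerate by (auto simp: nondegenerate_def Q_def)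
  have prod: "ideal_prod (UNIV :: 'a set) UNIV = UNIV"
    using ideal_prod_eq_Int[of UNIV "UNIV :: 'a set"] D_ideal[of \<one>] by (simp add: D_one)
  \<comment> \<open>An involution is surjective, and all values of \<open>u \<one>\<close> have the
    form \<open>\<pi> a h\<close>, so \<open>u_mult\<close> applies to every vector.\<close>
  have "x \<in> rep_space \<pi> UNIV" for x
    using u_in_rep_space[of \<one> "u \<one> x"] unfolding uu D_one by simp
  hence "u (\<one> \<otimes> \<one>) x = u \<one> (u \<one> x)" for x
    by (intro u_mult) (simp_all add: sinv_one D_one prod)
  thus ?thesis by (auto simp: uu)
qed

section \<open>The commutant of the representation and regularity of word operators\<close>

definition in_commutant :: "('h \<Rightarrow> 'h) \<Rightarrow> bool" where
  "in_commutant X \<longleftrightarrow> (\<forall>a h. X (\<pi> a h) = \<pi> a (X h))"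

lemma final_projection_commute:
  assumes g: "g \<in> carrier G" and R: "is_adjoint R' R"
    and inv: "\<And>x. x \<in> rep_space \<pi> (D g) \<Longrightarrow> R x \<in> rep_space \<pi> (D g)"
      "\<And>x. x \<in> rep_space \<pi> (D g) \<Longrightarrow> R' x \<in> rep_space \<pi> (D g)"
  shows "u g (u (sinv G g) (R x)) = R (u g (u (sinv G g) x))"
proof -
  have "is_adjoint (u g \<circ> u (sinv G g)) (u g \<circ> u (sinv G g))"
    by (rule is_adjoint_comp[OF u_adjoint[OF g] is_adjoint_sym[OF u_adjoint[OF g]]])
  hence "(u g \<circ> u (sinv G g)) (R x) = R ((u g \<circ> u (sinv G g)) x)"
    by (rule projection_commute[OF _ R]) (simp_all add: u_u_sinv g u_in_rep_space inv)
  thus ?thesis by simp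
qed

text \<open>\<open>X\<close> sends \<open>\<pi> d h\<close> to \<open>\<pi> d (X h)\<close>, so it
  leaves \<open>\<pi>(D g)H\<close> invariant, and it is its own adjoint.\<close>

lemma final_projection_commutant:
  assumes g: "g \<in> carrier G" and X: "is_adjoint X X" "in_commutant X"
  shows "u g (u (sinv G g) (X x)) = X (u g (u (sinv G g) x))"
proof -
  have "X x \<in> rep_space \<pi> (D g)" if "x \<in> rep_space \<pi> (D g)" for x
    using that X(2) by (auto simp: rep_space_def in_commutant_def)
  thus ?thesis by (intro final_projection_commute[OF g X(1)])
qed

text \<open>Covariance for the inverse of \<open>g\<close>, multiplied from the left by
  \<open>u g\<close>, which undoes \<open>u (sinv G g)\<close> on
  \<open>\<pi>(D g)H\<close>.\<close>

lemma \<pi>_u: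
  assumes g: "g \<in> carrier G" and a: "a \<in> D g"
  shows "\<pi> a (u g v) = u g (\<pi> (the (\<alpha> (sinv G g) a)) v)"
proof -
  have eq: "u (sinv G g) (\<pi> a (u g v)) = \<pi> (the (\<alpha> (sinv G g) a)) v"
    using u_covariant[of "sinv G g" a] sinv_props(1)[OF g] a
    by (simp add: sinv_sinv g fun_eq_iff)
  have "\<pi> a (u g v) \<in> rep_space \<pi> (D g)"
    using a by (auto simp: rep_space_def)
  from u_u_sinv[OF g this] show ?thesis unfolding eq by (rule sym)
qed

text \<open>For \<open>a\<close> in \<open>D g\<close>, covariance moves \<open>\<pi> a\<close>
  through both outer factors; general \<open>a\<close> are reduced to this case.\<close>

lemma conjugate_in_commutant:
  assumes g: "g \<in> carrier G" and X: "in_commutant X"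
  shows "in_commutant (u g \<circ> X \<circ> u (sinv G g))"
proof -
  let ?Y = "u g \<circ> X \<circ> u (sinv G g)"
  note g' = sinv_props(1)[OF g]
  have on_D: "?Y (\<pi> a v) = \<pi> a (?Y v)" if a: "a \<in> D g" for a v
  proof -
    have "a \<in> dom (\<alpha> (sinv G g))" using a dom_\<alpha>[OF g'] by (simp add: sinv_sinv g)
    then obtain b where ab: "\<alpha> (sinv G g) a = Some b" by blast
    hence "\<alpha> g b = Some a" using \<alpha>_inverse[OF g, of b a] by simp
    moreover have "b \<in> D (sinv G g)" using ab ran_\<alpha>[OF g'] by (auto simp: ran_def)
    ultimately have e: "u (sinv G g) (\<pi> a v) = \<pi> b (u (sinv G g) v)"
      using \<pi>_u[OF g', of b v] by (simp add: sinv_sinv g)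
    have "?Y (\<pi> a v) = u g (X (\<pi> b (u (sinv G g) v)))" by (simp only: comp_apply e)
    also have "\<dots> = u g (\<pi> b (X (u (sinv G g) v)))" using X by (simp only: in_commutant_def)
    also have "\<dots> = \<pi> a (?Y v)" by (simp only: comp_apply \<pi>_u[OF g a] ab option.sel)
    finally show ?thesis .
  qed
  \<comment> \<open>\<open>Q\<close> projects onto \<open>\<pi>(D g)H\<close>, commutes with
    \<open>\<pi>(A)\<close> and is absorbed by \<open>?Y\<close>. Since
    \<open>Q v = \<pi> d w\<close> with \<open>d\<close> in \<open>D g\<close>, a general
    \<open>a\<close> can be replaced by \<open>a * d\<close>, which lies in
    \<open>D g\<close>.\<close>
  define Q where "Q = u g \<circ> u (sinv G g)"
  have rs: "\<pi> a x \<in> rep_space \<pi> (D g)" if "x \<in> rep_space \<pi> (D g)" for a x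
  proof -
    obtain d h where "d \<in> D g" "x = \<pi> d h" using \<open>x \<in> _\<close> by (auto simp: rep_space_def)
    hence "a * d \<in> D g" "\<pi> a x = \<pi> (a * d) h"
      using closed_idealD(3)[OF D_ideal[OF g]] by (simp_all add: \<pi>_mult)
    thus ?thesis by (auto simp: rep_space_def)
  qed
  have Q\<pi>: "Q (\<pi> a v) = \<pi> a (Q v)" for a v
    unfolding Q_def comp_apply by (rule final_projection_commute[OF g \<pi>_adjoint]) (rule rs, assumption)+
  have YQ: "?Y (Q v) = ?Y v" for v
    using u_u_sinv_u[OF g', of v] by (simp add: Q_def sinv_sinv g)
  have "?Y (\<pi> a v) = \<pi> a (?Y v)" for a v
  proof -
    obtain d w where d: "d \<in> D g" and w: "Q v = \<pi> d w"
      using u_in_rep_space[OF g, of "u (sinv G g) v"] by (auto simp: Q_def rep_space_def)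
    have "?Y (\<pi> a v) = ?Y (\<pi> (a * d) w)"
      using YQ[of "\<pi> a v"] by (simp only: Q\<pi> w \<pi>_mult)
    also have "\<dots> = \<pi> a (\<pi> d (?Y w))"
      using on_D[of "a * d" w] d closed_idealD(3)[OF D_ideal[OF g]] by (simp add: \<pi>_mult)
    also have "\<dots> = \<pi> a (?Y (Q v))" by (simp only: on_D[OF d] w)
    finally show ?thesis by (simp only: YQ)
  qed
  thus ?thesis unfolding in_commutant_def by blast
qed

lemma op_word_adjoint:
  "set gs \<subseteq> carrier G \<Longrightarrow> is_adjoint (op_word u (inv_word G gs)) (op_word u gs)"
proof (induction gs)
  case Nil
  show ?case by (simp add: is_adjoint_def)
next
  case (Cons g gs)
  have "is_adjoint (op_word u (inv_word G gs) \<circ> u (sinv G g)) (u g \<circ> op_word u gs)"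
    by (intro is_adjoint_comp u_adjoint Cons.IH) (use Cons.prems in auto)
  thus ?case by (simp only: inv_word_simps op_word_append op_word_simps comp_id)
qed

lemma op_word_contraction: "set gs \<subseteq> carrier G \<Longrightarrow> norm (op_word u gs x) \<le> norm x"
proof (induction gs)
  case (Cons g gs)
  thus ?case using u_contraction[of g "op_word u gs x"] by simp
qed simp

lemma op_word_commutant:
  "set gs \<subseteq> carrier G \<Longrightarrow> in_commutant (op_word u gs \<circ> op_word u (inv_word G gs))"
proof (induction gs)
  case Nil
  show ?case by (simp add: in_commutant_def)
next
  case (Cons g gs)
  have "in_commutant (u g \<circ> (op_word u gs \<circ> op_word u (inv_word G gs)) \<circ> u (sinv G g))"
    by (intro conjugate_in_commutant Cons.IH) (use Cons.prems in auto)
  thus ?case by (simp only: inv_word_simps op_word_append op_word_simps comp_id comp_assoc)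
qed

text \<open>For \<open>g # gs\<close> the product is \<open>u t t' u' u t\<close> with
  \<open>t\<close> the operator of \<open>gs\<close> and primes for adjoints. As \<open>t t'\<close>
  is in the commutant, it commutes with \<open>u' u\<close>, leaving
  \<open>u u' u t t' t = u t\<close>.\<close>

lemma op_word_regular:
  "set gs \<subseteq> carrier G \<Longrightarrow> op_word u gs (op_word u (inv_word G gs) (op_word u gs x)) = op_word u gs x"
proof (induction gs)
  case (Cons g gs)
  let ?t = "op_word u gs" and ?t' = "op_word u (inv_word G gs)"
  have g: "g \<in> carrier G" and gs: "set gs \<subseteq> carrier G" using Cons.prems by auto
  have "is_adjoint (?t \<circ> ?t') (?t \<circ> ?t')"
    using is_adjoint_comp[OF op_word_adjoint[OF gs] is_adjoint_sym[OF op_word_adjoint[OF gs]]] .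
  from final_projection_commutant[OF sinv_props(1)[OF g] this op_word_commutant[OF gs], of "?t x"]
  have *: "?t (?t' (u (sinv G g) (u g (?t x)))) = u (sinv G g) (u g (?t x))"
    unfolding sinv_sinv[OF g] comp_apply Cons.IH[OF gs] by (rule sym)
  show ?case
    by (simp only: inv_word_simps op_word_append op_word_simps comp_apply id_apply * u_u_sinv_u[OF g])
qed simp

section \<open>The inverse semigroup of word pairs and its action\<close>

lemma word_pair_append:
  "mult (word_semigroup G \<alpha> u) (word_pair \<alpha> u gs) (word_pair \<alpha> u hs) = word_pair \<alpha> u (gs @ hs)"
  by (simp add: word_semigroup_def word_pair_def map_word_append op_word_append)

lemma word_pair_regular:
  assumes gs: "set gs \<subseteq> carrier G"
  shows "word_pair \<alpha> u (gs @ inv_word G gs @ gs) = word_pair \<alpha> u gs"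
proof -
  have "map_word \<alpha> (gs @ inv_word G gs @ gs) x = map_word \<alpha> gs x" for x
  proof (cases "map_word \<alpha> gs x")
    case (Some y)
    thus ?thesis using map_word_inv[OF gs, of x y] by (simp add: map_word_append map_comp_def)
  qed (simp add: map_word_append map_comp_def)
  thus ?thesis using op_word_regular[OF gs]
    by (auto simp: word_pair_def op_word_append fun_eq_iff)
qed

text \<open>The coordinates are treated separately: contractivity settles the operators, injectivity
  the partial maps.\<close>

lemma word_pair_inverse_unique:
  assumes gs: "set gs \<subseteq> carrier G" and hs: "set hs \<subseteq> carrier G" and ks: "set ks \<subseteq> carrier G"
    and h: "word_pair \<alpha> u (gs @ hs @ gs) = word_pair \<alpha> u gs"
      "word_pair \<alpha> u (hs @ gs @ hs) = word_pair \<alpha> u hs"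
    and k: "word_pair \<alpha> u (gs @ ks @ gs) = word_pair \<alpha> u gs"
      "word_pair \<alpha> u (ks @ gs @ ks) = word_pair \<alpha> u ks"
  shows "word_pair \<alpha> u hs = word_pair \<alpha> u ks"
proof -
  have "op_word u hs = op_word u ks"
    by (rule contractive_inverse_unique[OF op_word_adjoint[OF gs] op_word_adjoint[OF hs]
          op_word_adjoint[OF ks]])
      (use h k in \<open>simp_all add: op_word_contraction set_inv_word gs hs ks word_pair_def
        op_word_append comp_assoc\<close>)
  moreover have "map_word \<alpha> ls y = Some x \<longleftrightarrow> map_word \<alpha> gs x = Some y"
    if ls: "set ls \<subseteq> carrier G" and l: "word_pair \<alpha> u (gs @ ls @ gs) = word_pair \<alpha> u gs"
      "word_pair \<alpha> u (ls @ gs @ ls) = word_pair \<alpha> u ls" for ls x y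
    by (rule partial_injection_inverse_unique[OF map_word_inj[OF gs] map_word_inj[OF ls]])
      (use l in \<open>simp_all add: word_pair_def map_word_append map_comp_assoc\<close>)
  from this[OF hs h] this[OF ks k] have "map_word \<alpha> hs = map_word \<alpha> ks"
    by (intro ext) (metis not_Some_eq)
  ultimately show ?thesis by (simp add: word_pair_def)
qed

lemma carrier_word_semigroup: "carrier (word_semigroup G \<alpha> u) = word_pair \<alpha> u ` words G"
  by (simp add: word_semigroup_def)

text \<open>Shows that the pair of identities is represented by a nonempty word and so lies in the
  carrier.\<close>

lemma one_word_semigroup: "one (word_semigroup G \<alpha> u) = word_pair \<alpha> u [\<one>]"
  by (simp add: word_semigroup_def word_pair_def \<alpha>_one u_one)

lemma unital_inverse_semigroup_word_semigroup:
  "unital_inverse_semigroup (word_semigroup G \<alpha> u)"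
proof -
  let ?S = "word_semigroup G \<alpha> u"
  have w: "gs @ hs \<in> words G" if "gs \<in> words G" "hs \<in> words G" for gs hs
    using that by (auto simp: words_def)
  have one: "[\<one>] \<in> words G" by (simp add: words_def)
  have "monoid ?S"
  proof
    show "one ?S \<in> carrier ?S" using one by (auto simp: one_word_semigroup carrier_word_semigroup)
  qed (use w in \<open>auto simp: carrier_word_semigroup word_pair_append\<close>,
      auto simp: word_semigroup_def)
  moreover have "\<exists>!y. y \<in> carrier ?S \<and> s \<otimes>\<^bsub>?S\<^esub> y \<otimes>\<^bsub>?S\<^esub> s = s \<and> y \<otimes>\<^bsub>?S\<^esub> s \<otimes>\<^bsub>?S\<^esub> y = y"
    if s: "s \<in> carrier ?S" for s
  proof -
    obtain gs where gs: "gs \<in> words G" "s = word_pair \<alpha> u gs"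
      using s by (auto simp: carrier_word_semigroup)
    hence gs': "set gs \<subseteq> carrier G" by (simp add: words_def)
    note inv = word_pair_regular[OF gs'] word_pair_regular[OF set_inv_word[OF gs']]
    show ?thesis
    proof (rule ex1I[of _ "word_pair \<alpha> u (inv_word G gs)"])
      show "word_pair \<alpha> u (inv_word G gs) \<in> carrier ?S \<and>
          s \<otimes>\<^bsub>?S\<^esub> word_pair \<alpha> u (inv_word G gs) \<otimes>\<^bsub>?S\<^esub> s = s \<and>
          word_pair \<alpha> u (inv_word G gs) \<otimes>\<^bsub>?S\<^esub> s \<otimes>\<^bsub>?S\<^esub> word_pair \<alpha> u (inv_word G gs)
            = word_pair \<alpha> u (inv_word G gs)"
        using inv inv_word_words[OF gs(1)]
        by (simp add: carrier_word_semigroup gs(2) word_pair_append inv_word_inv_word[OF gs'])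
    next
      fix y assume y: "y \<in> carrier ?S \<and> s \<otimes>\<^bsub>?S\<^esub> y \<otimes>\<^bsub>?S\<^esub> s = s \<and> y \<otimes>\<^bsub>?S\<^esub> s \<otimes>\<^bsub>?S\<^esub> y = y"
      then obtain hs where hs: "set hs \<subseteq> carrier G" "y = word_pair \<alpha> u hs"
        by (auto simp: carrier_word_semigroup words_def)
      show "y = word_pair \<alpha> u (inv_word G gs)"
        unfolding hs(2)
        by (rule word_pair_inverse_unique[OF gs' hs(1) set_inv_word[OF gs']])
          (use y inv in \<open>simp_all add: hs(2) gs(2) word_pair_append inv_word_inv_word[OF gs']\<close>)
    qed
  qed
  ultimately show ?thesis
    by (simp add: unital_inverse_semigroup_def unital_inverse_semigroup_axioms_def)
qed

lemma sinv_word_semigroup: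
  assumes gs: "gs \<in> words G"
  shows "sinv (word_semigroup G \<alpha> u) (word_pair \<alpha> u gs) = word_pair \<alpha> u (inv_word G gs)"
proof -
  have gs': "set gs \<subseteq> carrier G" using gs by (simp add: words_def)
  show ?thesis
    using word_pair_regular[OF gs'] word_pair_regular[OF set_inv_word[OF gs']] gs inv_word_words[OF gs]
    by (intro unital_inverse_semigroup.sinv_eqI[OF unital_inverse_semigroup_word_semigroup])
      (simp_all add: carrier_word_semigroup word_pair_append inv_word_inv_word[OF gs'])
qed

text \<open>The inverse of a pair has the converse partial map as first coordinate, so its range is
  the domain required of the isomorphism. Compatibility with products is built into the
  multiplication.\<close>

lemma inverse_semigroup_action_word_semigroup:
  "inverse_semigroup_action (word_semigroup G \<alpha> u) (\<lambda>s. ran (fst s)) fst"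
proof -
  let ?S = "word_semigroup G \<alpha> u"
  have "closed_ideal (ran (fst s))" "star_isomorphism (ran (fst (sinv ?S s))) (ran (fst s)) (fst s)"
    if s: "s \<in> carrier ?S" for s
  proof -
    obtain gs where gs: "gs \<in> words G" "s = word_pair \<alpha> u gs"
      using s by (auto simp: carrier_word_semigroup)
    hence gs': "set gs \<subseteq> carrier G" by (simp add: words_def)
    show "closed_ideal (ran (fst s))"
      using word_ideal_eq[OF gs(1)] by (simp add: gs(2) word_pair_def)
    have "star_isomorphism (dom (map_word \<alpha> gs)) (ran (map_word \<alpha> gs)) (map_word \<alpha> gs)"
      using star_partial_hom_map_word[OF gs'] map_word_inj[OF gs']
      by (rule star_partial_hom_isomorphism)
    thus "star_isomorphism (ran (fst (sinv ?S s))) (ran (fst s)) (fst s)"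
      unfolding gs(2) sinv_word_semigroup[OF gs(1)] by (simp add: word_pair_def ran_map_word_inv[OF gs'])
  qed
  thus ?thesis
    using unital_inverse_semigroup_word_semigroup
    by (simp add: inverse_semigroup_action_def inverse_semigroup_action_axioms_def)
      (auto simp: word_semigroup_def ran_def)
qed

end

theorem proposition2p10:
  fixes G :: "('g, 'm) monoid_scheme"
    and D :: "'g \<Rightarrow> 'a::cstar_algebra set"
    and \<alpha> :: "'g \<Rightarrow> 'a \<rightharpoonup> 'a"
    and \<pi> :: "'a \<Rightarrow> 'h::complex_hilbert_space \<Rightarrow> 'h"
    and u :: "'g \<Rightarrow> 'h \<Rightarrow> 'h"
  assumes "unital_inverse_semigroup G"
    and "partial_action G D \<alpha>"
    and "covariant_representation G D \<alpha> \<pi> u"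
  shows "unital_inverse_semigroup (word_semigroup G \<alpha> u) \<and>
    (\<exists>E \<beta>.
      (\<forall>gs \<in> words G.
         E (word_pair \<alpha> u gs) = word_ideal G D gs \<and>
         \<beta> (word_pair \<alpha> u gs) = map_word \<alpha> gs) \<and>
      inverse_semigroup_action (word_semigroup G \<alpha> u) E \<beta>)"
proof -
  interpret covariant_representation G D \<alpha> \<pi> u by fact
  show ?thesis
  \<comment> \<open>The witnesses are \<open>ran (fst s)\<close> for \<open>E s\<close> and
    \<open>fst s\<close> for \<open>\<beta> s\<close>, functions of the pair rather than of a
    word.\<close>
  proof (intro conjI exI ballI)
    show "ran (fst (word_pair \<alpha> u gs)) = word_ideal G D gs" if "gs \<in> words G" for gs
      using word_ideal_eq(1)[OF that] by (simp add: word_pair_def)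
    show "fst (word_pair \<alpha> u gs) = map_word \<alpha> gs" for gs
      by (simp add: word_pair_def)
  qed (rule unital_inverse_semigroup_word_semigroup inverse_semigroup_action_word_semigroup)+
qed

end
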